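(* Let $\Omega\subset\mathbb{R}^2$ be a connected open set with coordinates $(R^1,R^2)$, $\partial_i=\partial/\partial R^i$. Let $p,q,V,W:\Omega\to\mathbb{R}$ be smooth functions, with $p$ and $q$ nowhere zero, satisfying $$\partial_2^3p-2W\partial_2p-p\,\partial_2W+\partial_1^3q-2V\partial_1q-q\,\partial_1V=0,\qquad \partial_1W=2q\,\partial_2p+p\,\partial_2q,\qquad \partial_2V=2p\,\partial_1q+q\,\partial_1p .$$ Let $\psi:\Omega\to\mathbb{C}^4$ be a smooth map satisfying (componentwise) $$\partial_1^2\psi=-ip\,\partial_2\psi+\tfrac12(V+i\,\partial_2p)\,\psi,\qquad \partial_2^2\psi=iq\,\partial_1\psi+\tfrac12(W-i\,\partial_1q)\,\psi ,$$ and normalized, at every point of $\Omega$, by $$(\psi,\partial_1\partial_2\psi)=(\partial_1\partial_2\psi,\psi)=-1,\quad (\partial_1\psi,\partial_2\psi)=(\partial_2\psi,\partial_1\psi)=1,\quad (\partial_1\partial_2\psi,\partial_1\partial_2\psi)=-pq,$$ all other pseudo-Hermitian products $(\cdot,\cdot)$ among $\psi,\partial_1\psi,\partial_2\psi,\partial_1\partial_2\psi$ being zero, and by $\det(\psi,\partial_1\psi,\partial_2\psi,\partial_1\partial_2\psi)=1$. Define the real vectors in $\Lambda^2(\mathbb{C}^4)\cong\mathbb{C}^6$ $$\mathbf U=i\,\psi\wedge\partial_1\psi-i\,\overline{\psi\wedge\partial_1\psi},\qquad \mathbf V=\psi\wedge\partial_2\psi+\overline{\psi\wedge\partial_2\psi}.$$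 Then $\mathbf U$ and $\mathbf V$ have zero norm: $(\mathbf U,\mathbf U)=(\mathbf V,\mathbf V)=0$. Moreover, the triple $\mathbf U,\partial_2\mathbf U,\partial_2^2\mathbf U$ is orthogonal to the triple $\mathbf V,\partial_1\mathbf V,\partial_1^2\mathbf V$ (every vector of the first triple is orthogonal to every vector of the second). Hence, $\mathbf U$ and $\mathbf V$ are the curvature spheres of a surface with curvature line coordinates $R^1,R^2$.
   Context: Pseudo-Hermitian product on $\mathbb{C}^4$ (signature $(2,2)$): for $\mathbf a=(a^0,\dots,a^3)$, $\mathbf b=(b^0,\dots,b^3)$, $$(\mathbf a,\mathbf b)=-a^0\bar b^3+a^1\bar b^2+a^2\bar b^1-a^3\bar b^0 .$$ Wedge product, identifying $\Lambda^2(\mathbb{C}^4)$ with $\mathbb{C}^6$: with $p_{ij}=a^ib^j-a^jb^i$, $\mathbf a\wedge\mathbf b=(y^0,\dots,y^5)$, where $$y^0=\tfrac12(p_{02}-p_{31}),\quad y^1=\tfrac12(p_{02}+p_{31}),\quad y^2=\tfrac12(p_{03}+p_{12}),$$ $$y^3=\tfrac1{2i}(p_{03}-p_{12}),\quad y^4=\tfrac1{2i}(p_{01}-p_{23}),\quad y^5=\tfrac1{2i}(p_{01}+p_{23}).$$ Complex conjugation on $\Lambda^2(\mathbb{C}^4)$ is componentwise in $(y^0,\dots,y^5)$, and "real" means all $y^j$ are real. Pseudo-Hermitian product on $\Lambda^2(\mathbb{C}^4)$ (signature $(4,2)$): $$(y,Y)=-y^0\bar Y^0+y^1\bar Y^1+y^2\bar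 Y^2+y^3\bar Y^3+y^4\bar Y^4-y^5\bar Y^5 ,$$ which satisfies $(\mathbf a\wedge\mathbf b,\mathbf A\wedge\mathbf B)=\frac12\big((\mathbf a,\mathbf B)(\mathbf b,\mathbf A)-(\mathbf a,\mathbf A)(\mathbf b,\mathbf B)\big)$. On real vectors it is the Lie quadratic form $-y_0^2+y_1^2+y_2^2+y_3^2+y_4^2-y_5^2$ on $\mathbb{R}^6$. Here $\det(\mathbf a,\mathbf b,\mathbf A,\mathbf B)$ is the determinant of the $4\times4$ matrix with rows $\mathbf a,\mathbf b,\mathbf A,\mathbf B$. Lie sphere geometry: an oriented sphere in $E^3$ with center $\mathbf c$ and (signed) radius $R$ is represented by the point of the Lie quadric $-y_0^2+y_1^2+y_2^2+y_3^2+y_4^2-y_5^2=0$ with homogeneous hexaspherical coordinates $\left(\frac{1+\mathbf c^2-R^2}{2},\frac{1-\mathbf c^2+R^2}{2},\mathbf c,R\right)$. Null vectors of $\mathbb{R}^6$ are regarded as (generalized) oriented spheres up to nonzero scale, and two spheres are in oriented contact iff their vectors are orthogonal. Maps $\mathbf U,\mathbf V:\Omega\to\mathbb{R}^6$ are called the curvature spheres of a surface with curvature line coordinates $R^1,R^2$ (surface understood in the sense of Lie sphere geometry, i.e. as an immersed Legendre surface, the common envelope of the two families of spheres) if at each point $(\mathbf U,\mathbf U)=(\mathbf U,\mathbf V)=(\mathbf V,\mathbf V)=0$, $\partial_1\mathbf U\in\mathrm{span}(\mathbf U,\mathbf V)$, $\partial_2\mathbf V\in\mathrm{span}(\mathbf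 U,\mathbf V)$, and $\mathbf U,\mathbf V,\partial_2\mathbf U,\partial_1\mathbf V$ are linearly independent. For a surface in $E^3$ with radius vector $\mathbf r$, unit normal $\mathbf n$, and radii of principal curvature $w^1\ne w^2$ with $\partial_i\mathbf r=w^i\partial_i\mathbf n$, these are, up to scale, the spheres of radii $w^i$ centered at $\mathbf r-w^i\mathbf n$. *)

theory Defs
  imports "HOL-Analysis.Analysis"
begin

text \<open>
  \<open>C\<^sup>n\<close> and \<open>C\<^sup>\<infinity>\<close> regularity, to be used for open \<open>S\<close>: every iterated directional
  derivative of order at most \<open>n\<close> exists and is continuous.
\<close>

primrec times_differentiable_on ::
    "nat \<Rightarrow> 'a::real_normed_vector set \<Rightarrow> ('a \<Rightarrow> 'b::real_normed_vector) \<Rightarrow> bool" where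
  "times_differentiable_on 0 S f \<longleftrightarrow> continuous_on S f"
| "times_differentiable_on (Suc n) S f \<longleftrightarrow>
     (\<forall>x\<in>S. f differentiable (at x)) \<and>
     (\<forall>v. times_differentiable_on n S (\<lambda>x. frechet_derivative f (at x) v))"

definition smooth_on :: "'a::real_normed_vector set \<Rightarrow> ('a \<Rightarrow> 'b::real_normed_vector) \<Rightarrow> bool" where
  "smooth_on S f \<longleftrightarrow> (\<forall>n. times_differentiable_on n S f)"

text \<open>
  The coordinates on \<open>real ^ 2\<close> are \<open>x $ 1\<close> and \<open>x $ 2\<close>; in the numeral type, \<open>2 = 0\<close>.
\<close>

definition pd :: "2 \<Rightarrow> (real ^ 2 \<Rightarrow> 'a::real_normed_vector) \<Rightarrow> real ^ 2 \<Rightarrow> 'a" where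
  "pd i f x = frechet_derivative f (at x) (axis i 1)"

text \<open>
  Vectors of \<open>complex ^ 4\<close> and \<open>complex ^ 6\<close> are indexed by \<open>0, \<dots>, 3\<close> and \<open>0, \<dots>, 5\<close>.
  The function \<open>vector\<close> is avoided throughout, since it numbers its entries from \<open>1\<close>,
  so that its last entry has index \<open>0\<close>; this would change the sign of \<open>det4\<close>.
\<close>

definition herm4 :: "complex ^ 4 \<Rightarrow> complex ^ 4 \<Rightarrow> complex" where
  "herm4 a b = - a $ 0 * cnj (b $ 3) + a $ 1 * cnj (b $ 2) + a $ 2 * cnj (b $ 1) - a $ 3 * cnj (b $ 0)"

definition det4 :: "complex ^ 4 \<Rightarrow> complex ^ 4 \<Rightarrow> complex ^ 4 \<Rightarrow> complex ^ 4 \<Rightarrow> complex" where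
  "det4 a b c d = det (\<chi> i. if i = 0 then a else if i = 1 then b else if i = 2 then c else d)"

definition wedge :: "complex ^ 4 \<Rightarrow> complex ^ 4 \<Rightarrow> complex ^ 6" where
  "wedge a b =
     (let p = (\<lambda>i j. a $ i * b $ j - a $ j * b $ i) in
      \<chi> k. if k = 0 then (p 0 2 - p 3 1) / 2
           else if k = 1 then (p 0 2 + p 3 1) / 2
           else if k = 2 then (p 0 3 + p 1 2) / 2
           else if k = 3 then (p 0 3 - p 1 2) / (2 * \<i>)
           else if k = 4 then (p 0 1 - p 2 3) / (2 * \<i>)
           else (p 0 1 + p 2 3) / (2 * \<i>))"

definition herm6 :: "complex ^ 6 \<Rightarrow> complex ^ 6 \<Rightarrow> complex" where
  "herm6 y z = - y $ 0 * cnj (z $ 0) + y $ 1 * cnj (z $ 1) + y $ 2 * cnj (z $ 2)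
             + y $ 3 * cnj (z $ 3) + y $ 4 * cnj (z $ 4) - y $ 5 * cnj (z $ 5)"

definition cnj_vec :: "complex ^ 'n \<Rightarrow> complex ^ 'n" where
  "cnj_vec y = (\<chi> k. cnj (y $ k))"

definition Re_vec :: "complex ^ 'n \<Rightarrow> real ^ 'n" where
  "Re_vec y = (\<chi> k. Re (y $ k))"

definition real_vec :: "complex ^ 'n \<Rightarrow> bool" where
  "real_vec y \<longleftrightarrow> (\<forall>k. y $ k \<in> \<real>)"

definition lie_form :: "real ^ 6 \<Rightarrow> real ^ 6 \<Rightarrow> real" where
  "lie_form y z = - y $ 0 * z $ 0 + y $ 1 * z $ 1 + y $ 2 * z $ 2
                + y $ 3 * z $ 3 + y $ 4 * z $ 4 - y $ 5 * z $ 5"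

text \<open>
  \<open>U\<close> and \<open>V\<close> represent, up to scale, two families of oriented spheres in hexaspherical
  coordinates; they are the curvature spheres of the immersed Legendre surface enveloping
  both families, with the two coordinates as curvature line coordinates.
\<close>

definition curvature_spheres ::
    "(real ^ 2) set \<Rightarrow> (real ^ 2 \<Rightarrow> real ^ 6) \<Rightarrow> (real ^ 2 \<Rightarrow> real ^ 6) \<Rightarrow> bool" where
  "curvature_spheres S U V \<longleftrightarrow>
     smooth_on S U \<and> smooth_on S V \<and>
     (\<forall>x\<in>S.
        lie_form (U x) (U x) = 0 \<and> lie_form (U x) (V x) = 0 \<and> lie_form (V x) (V x) = 0 \<and>
        pd 1 U x \<in> span {U x, V x} \<and>
        pd 2 V x \<in> span {U x, V x} \<and>
        distinct [U x, V x, pd 2 U x, pd 1 V x] \<and>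
        independent {U x, V x, pd 2 U x, pd 1 V x})"

text \<open>
  In the next definition \<open>a, b, c, d\<close> stand for \<open>\<psi>, \<partial>\<^sub>1\<psi>, \<partial>\<^sub>2\<psi>, \<partial>\<^sub>1\<partial>\<^sub>2\<psi>\<close> at a point.
\<close>

definition normalized_frame ::
    "real \<Rightarrow> real \<Rightarrow> complex ^ 4 \<Rightarrow> complex ^ 4 \<Rightarrow> complex ^ 4 \<Rightarrow> complex ^ 4 \<Rightarrow> bool" where
  "normalized_frame p q a b c d \<longleftrightarrow>
     herm4 a a = 0  \<and> herm4 a b = 0 \<and> herm4 a c = 0 \<and> herm4 a d = - 1 \<and>
     herm4 b a = 0  \<and> herm4 b b = 0 \<and> herm4 b c = 1 \<and> herm4 b d = 0 \<and>
     herm4 c a = 0  \<and> herm4 c b = 1 \<and> herm4 c c = 0 \<and> herm4 c d = 0 \<and>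
     herm4 d a = - 1 \<and> herm4 d b = 0 \<and> herm4 d c = 0 \<and> herm4 d d = - of_real (p * q) \<and>
     det4 a b c d = 1"

definition sphere_U :: "(real ^ 2 \<Rightarrow> complex ^ 4) \<Rightarrow> real ^ 2 \<Rightarrow> complex ^ 6" where
  "sphere_U \<psi> x = \<i> *s wedge (\<psi> x) (pd 1 \<psi> x) - \<i> *s cnj_vec (wedge (\<psi> x) (pd 1 \<psi> x))"

definition sphere_V :: "(real ^ 2 \<Rightarrow> complex ^ 4) \<Rightarrow> real ^ 2 \<Rightarrow> complex ^ 6" where
  "sphere_V \<psi> x = wedge (\<psi> x) (pd 2 \<psi> x) + cnj_vec (wedge (\<psi> x) (pd 2 \<psi> x))"

end

theory Submission
  imports Defs
begin

text \<open>
  Write \<open>a, b, c, d\<close> for \<open>\<psi>, \<partial>\<^sub>1\<psi>, \<partial>\<^sub>2\<psi>, \<partial>\<^sub>1\<partial>\<^sub>2\<psi>\<close>. The product of \<open>a \<and> b\<close> with the conjugate of \<open>c \<and> d\<close>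
  is half the determinant of the four vectors, so the normalization determines conjugation on the
  bivectors of the frame; it gives \<open>\<^bold>U = 2 \<i> a \<and> b\<close> and \<open>\<^bold>V = 2 a \<and> c\<close>. The equations for \<open>\<psi>\<close> then yield
  \<open>\<partial>\<^sub>1\<^bold>U = p \<^bold>V\<close>, \<open>\<partial>\<^sub>2\<^bold>V = q \<^bold>U\<close>, \<open>\<partial>\<^sub>2\<^bold>U = 2 \<i> (a \<and> d - b \<and> c)\<close>, \<open>\<partial>\<^sub>1\<^bold>V = 2 (a \<and> d + b \<and> c)\<close>,
  \<open>\<partial>\<^sub>2\<^sup>2\<^bold>U = 2 \<i> (W a \<and> b + 2 c \<and> d + p q a \<and> c)\<close> and \<open>\<partial>\<^sub>1\<^sup>2\<^bold>V = 2 (V a \<and> c + 2 b \<and> d + p q a \<and> b)\<close>,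
  and every claim is read off from the Gram matrix of these vectors. Linear independence follows by
  pairing a relation with \<open>\<partial>\<^sub>2\<^bold>U\<close>, \<open>\<partial>\<^sub>1\<^bold>V\<close>, \<open>\<partial>\<^sub>2\<^sup>2\<^bold>U\<close>, \<open>\<partial>\<^sub>1\<^sup>2\<^bold>V\<close> in turn.
\<close>

subsection \<open>Smooth maps and partial derivatives\<close>

text \<open>\<open>frechet_derivative\<close> is a choice among the derivatives at the point. Maps
  that agree near \<open>x\<close> have the same derivatives at \<open>x\<close>, so the same one is
  chosen, even where there is none.\<close>

lemma frechet_derivative_cong_open:
  assumes "open S" "x \<in> S" "\<And>y. y \<in> S \<Longrightarrow> f y = g y"
  shows "frechet_derivative f (at x) = frechet_derivative g (at x)"
proof -
  have "(f has_derivative f') (at x) = (g has_derivative f') (at x)" for f'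
    using has_derivative_transform_within_open[of f f' x UNIV S g]
      has_derivative_transform_within_open[of g f' x UNIV S f] assms by auto
  then show ?thesis
    by (simp add: frechet_derivative_def)
qed

lemma frechet_derivative_bounded_linear:
  assumes "bounded_linear h" "f differentiable (at x)"
  shows "frechet_derivative (\<lambda>x. h (f x)) (at x) = (\<lambda>v. h (frechet_derivative f (at x) v))"
  using bounded_linear.has_derivative[OF assms(1) assms(2)[unfolded frechet_derivative_works]]
  by (rule frechet_derivative_at[symmetric])

lemma bounded_linear_differentiable_at:
  assumes "bounded_linear h" "f differentiable (at x)"
  shows "(\<lambda>x. h (f x)) differentiable (at x)"
  using bounded_linear.has_derivative[OF assms(1) assms(2)[unfolded frechet_derivative_works]]
  by (rule differentiableI)

lemma frechet_derivative_bounded_bilinear: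
  assumes "bounded_bilinear B" "f differentiable (at x)" "g differentiable (at x)"
  shows "frechet_derivative (\<lambda>x. B (f x) (g x)) (at x) =
    (\<lambda>v. B (f x) (frechet_derivative g (at x) v) + B (frechet_derivative f (at x) v) (g x))"
  using bounded_bilinear.FDERIV[OF assms(1) assms(2,3)[unfolded frechet_derivative_works]]
  by (rule frechet_derivative_at[symmetric])

lemma bounded_bilinear_differentiable_at:
  assumes "bounded_bilinear B" "f differentiable (at x)" "g differentiable (at x)"
  shows "(\<lambda>x. B (f x) (g x)) differentiable (at x)"
  using bounded_bilinear.FDERIV[OF assms(1) assms(2,3)[unfolded frechet_derivative_works]]
  by (rule differentiableI)

section \<open>Closure properties of the classes of differentiable maps\<close>

text \<open>Formulas for a derivative hold only on \<open>S\<close>. Since \<open>S\<close> is open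
  they may replace the derivative under every further differentiation, which the inductions on the
  order below rely on.\<close>

lemma times_differentiable_on_cong:
  assumes "open S" "\<And>x. x \<in> S \<Longrightarrow> f x = g x" "times_differentiable_on n S f"
  shows "times_differentiable_on n S g"
  using assms(2,3)
proof (induction n arbitrary: f g)
  case 0
  then show ?case by (simp cong: continuous_on_cong)
next
  case (Suc n)
  have "g differentiable (at x)" if "x \<in> S" for x
    using Suc.prems that assms(1) unfolding differentiable_def
    by (metis has_derivative_transform_within_open times_differentiable_on.simps(2) differentiable_def)
  moreover have "times_differentiable_on n S (\<lambda>x. frechet_derivative g (at x) v)" for v
  proof (rule Suc.IH)
    show "times_differentiable_on n S (\<lambda>x. frechet_derivative f (at x) v)"
      using Suc.prems by simp
    show "frechet_derivative f (at x) v = frechet_derivative g (at x) v" if "x \<in> S" for x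
      using frechet_derivative_cong_open[OF assms(1) that, of f g] Suc.prems(1) by simp
  qed
  ultimately show ?case by simp
qed

lemma times_differentiable_on_Suc_imp:
  "times_differentiable_on (Suc n) S f \<Longrightarrow> times_differentiable_on n S f"
proof (induction n arbitrary: f)
  case 0
  then have "f differentiable_on S"
    by (auto intro: differentiable_at_imp_differentiable_on)
  then show ?case
    by (simp add: differentiable_imp_continuous_on)
next
  case (Suc n)
  then show ?case
    by (meson times_differentiable_on.simps(2))
qed

lemma times_differentiable_on_add:
  assumes "open S" "times_differentiable_on n S f" "times_differentiable_on n S g"
  shows "times_differentiable_on n S (\<lambda>x. f x + g x)"
  using assms(2,3)
proof (induction n arbitrary: f g)
  case 0
  then show ?case by (simp add: continuous_on_add)
next
  case (Suc n)
  show ?case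
    unfolding times_differentiable_on.simps
  proof (intro conjI allI ballI)
    fix x assume "x \<in> S"
    then show "(\<lambda>x. f x + g x) differentiable at x"
      using Suc.prems by simp
  next
    fix v
    show "times_differentiable_on n S (\<lambda>x. frechet_derivative (\<lambda>x. f x + g x) (at x) v)"
    proof (rule times_differentiable_on_cong[OF assms(1)])
      show "times_differentiable_on n S
          (\<lambda>x. frechet_derivative f (at x) v + frechet_derivative g (at x) v)"
        using Suc by simp
      show "frechet_derivative f (at x) v + frechet_derivative g (at x) v
          = frechet_derivative (\<lambda>x. f x + g x) (at x) v" if "x \<in> S" for x
        using Suc.prems that
        by (subst frechet_derivative_at[OF has_derivative_add, symmetric])
          (auto simp: frechet_derivative_works)
    qed
  qed
qed

lemma times_differentiable_on_bounded_linear: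
  assumes "open S" "bounded_linear h" "times_differentiable_on n S f"
  shows "times_differentiable_on n S (\<lambda>x. h (f x))"
  using assms(3)
proof (induction n arbitrary: f)
  case 0
  then show ?case using bounded_linear.continuous_on[OF assms(2)] by simp
next
  case (Suc n)
  have "times_differentiable_on n S (\<lambda>x. frechet_derivative (\<lambda>x. h (f x)) (at x) v)" for v
  proof (rule times_differentiable_on_cong[OF assms(1)])
    show "times_differentiable_on n S (\<lambda>x. h (frechet_derivative f (at x) v))"
      using Suc by simp
    show "h (frechet_derivative f (at x) v) = frechet_derivative (\<lambda>x. h (f x)) (at x) v"
      if "x \<in> S" for x
      using frechet_derivative_bounded_linear[OF assms(2), of f x] Suc.prems that by simp
  qed
  then show ?case
    using Suc.prems by (auto intro: bounded_linear_differentiable_at[OF assms(2)])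
qed

lemma times_differentiable_on_bounded_bilinear:
  assumes "open S" "bounded_bilinear B"
    and "times_differentiable_on n S f" "times_differentiable_on n S g"
  shows "times_differentiable_on n S (\<lambda>x. B (f x) (g x))"
  using assms(3,4)
proof (induction n arbitrary: f g)
  case 0
  then show ?case using bounded_bilinear.continuous_on[OF assms(2)] by simp
next
  case (Suc n)
  \<comment> \<open>Each term of the product rule keeps one factor undifferentiated. The induction
    hypothesis asks for order \<open>n\<close> of both factors, so this one is lowered from
    \<open>Suc n\<close>.\<close>
  have lower: "times_differentiable_on n S f" "times_differentiable_on n S g"
    using Suc.prems by (simp_all only: times_differentiable_on_Suc_imp)
  have "times_differentiable_on n S (\<lambda>x. frechet_derivative (\<lambda>x. B (f x) (g x)) (at x) v)" for v
  proof (rule times_differentiable_on_cong[OF assms(1)])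
    show "times_differentiable_on n S
        (\<lambda>x. B (f x) (frechet_derivative g (at x) v) + B (frechet_derivative f (at x) v) (g x))"
      using Suc.prems
      by (intro times_differentiable_on_add[OF assms(1)] Suc.IH[OF lower(1)] Suc.IH[OF _ lower(2)])
        simp_all
    show "B (f x) (frechet_derivative g (at x) v) + B (frechet_derivative f (at x) v) (g x)
        = frechet_derivative (\<lambda>x. B (f x) (g x)) (at x) v" if "x \<in> S" for x
      using frechet_derivative_bounded_bilinear[OF assms(2), of f x g] Suc.prems that by simp
  qed
  then show ?case
    using Suc.prems by (auto intro: bounded_bilinear_differentiable_at[OF assms(2)])
qed

lemma smooth_on_times_differentiable_on: "smooth_on S f \<Longrightarrow> times_differentiable_on n S f"
  by (simp add: smooth_on_def)

lemma smooth_on_cong: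
  assumes "open S" "\<And>x. x \<in> S \<Longrightarrow> f x = g x" "smooth_on S f"
  shows "smooth_on S g"
  unfolding smooth_on_def
  by (rule allI)
    (rule times_differentiable_on_cong[OF assms(1,2) smooth_on_times_differentiable_on[OF assms(3)]])

lemma smooth_on_bounded_linear:
  assumes "open S" "bounded_linear h" "smooth_on S f"
  shows "smooth_on S (\<lambda>x. h (f x))"
  unfolding smooth_on_def
proof
  show "times_differentiable_on n S (\<lambda>x. h (f x))" for n
    by (rule times_differentiable_on_bounded_linear[OF assms(1,2)
          smooth_on_times_differentiable_on[OF assms(3)]])
qed

lemma smooth_on_bounded_bilinear:
  assumes "open S" "bounded_bilinear B" "smooth_on S f" "smooth_on S g"
  shows "smooth_on S (\<lambda>x. B (f x) (g x))"
  unfolding smooth_on_def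
proof
  show "times_differentiable_on n S (\<lambda>x. B (f x) (g x))" for n
    by (rule times_differentiable_on_bounded_bilinear[OF assms(1,2)
          assms(3,4)[THEN smooth_on_times_differentiable_on]])
qed

lemma smooth_on_frechet_derivative:
  assumes "smooth_on S f"
  shows "smooth_on S (\<lambda>x. frechet_derivative f (at x) v)"
  unfolding smooth_on_def
proof
  show "times_differentiable_on n S (\<lambda>x. frechet_derivative f (at x) v)" for n
    using smooth_on_times_differentiable_on[OF assms, of "Suc n"] by simp
qed

lemma smooth_on_pd: "smooth_on S f \<Longrightarrow> smooth_on S (pd i f)"
  using smooth_on_frechet_derivative[of S f "axis i 1"] by (simp add: pd_def[abs_def])

lemma smooth_on_imp_differentiable:
  assumes "smooth_on S f" "x \<in> S"
  shows "f differentiable (at x)"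
  using smooth_on_times_differentiable_on[OF assms(1), of "Suc 0"] assms(2) by simp

section \<open>Symmetry of second derivatives\<close>

text \<open>The mean value theorem is applied twice: in direction \<open>u\<close> to the difference
  of \<open>f\<close> at two points \<open>h *\<^sub>R v\<close> apart, then in direction
  \<open>v\<close> to the derivative along \<open>u\<close>. The second difference is symmetric in
  \<open>u\<close> and \<open>v\<close>, so it can compare the two mixed derivatives.\<close>

lemma second_difference_mean_value:
  fixes f :: "'a::real_normed_vector \<Rightarrow> real"
  assumes f: "\<And>y. y \<in> ball x r \<Longrightarrow> f differentiable (at y)"
    and f': "\<And>y. y \<in> ball x r \<Longrightarrow> (\<lambda>y. frechet_derivative f (at y) u) differentiable (at y)"
    and h: "0 < h" "h * (norm u + norm v) < r"
  obtains y where "norm (y - x) \<le> h * (norm u + norm v)"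
    and "f (x + h *\<^sub>R u + h *\<^sub>R v) - f (x + h *\<^sub>R u) - f (x + h *\<^sub>R v) + f x
      = h\<^sup>2 * frechet_derivative (\<lambda>y. frechet_derivative f (at y) u) (at y) v"
proof -
  define f1 where "f1 y = frechet_derivative f (at y) u" for y
  have bnd: "norm (s *\<^sub>R u + t *\<^sub>R v) \<le> h * (norm u + norm v)"
    if "s \<in> {0..h}" "t \<in> {0..h}" for s t
  proof -
    have "norm (s *\<^sub>R u + t *\<^sub>R v) \<le> s * norm u + t * norm v"
      using that norm_triangle_ineq[of "s *\<^sub>R u" "t *\<^sub>R v"] by simp
    also have "\<dots> \<le> h * norm u + h * norm v"
      using that by (intro add_mono mult_right_mono) auto
    finally show ?thesis by (simp add: algebra_simps)
  qed
  have in_ball: "x + s *\<^sub>R u + t *\<^sub>R v \<in> ball x r" if "s \<in> {0..h}" "t \<in> {0..h}" for s t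
  proof -
    have "dist x (x + s *\<^sub>R u + t *\<^sub>R v) = norm (s *\<^sub>R u + t *\<^sub>R v)"
      unfolding dist_norm by (metis add.assoc add_diff_cancel_left' norm_minus_commute)
    then show ?thesis
      using bnd[OF that] h(2) by simp
  qed
  have d1: "((\<lambda>s. f (x + s *\<^sub>R u + t *\<^sub>R v)) has_real_derivative f1 (x + s *\<^sub>R u + t *\<^sub>R v)) (at s)"
    if "s \<in> {0..h}" "t \<in> {0..h}" for s t
  proof -
    let ?y = "x + s *\<^sub>R u + t *\<^sub>R v"
    have F: "(f has_derivative frechet_derivative f (at ?y)) (at ?y)"
      using f[OF in_ball[OF that]] by (simp add: frechet_derivative_works)
    have "((\<lambda>s. x + s *\<^sub>R u + t *\<^sub>R v) has_derivative (\<lambda>k. k *\<^sub>R u)) (at s)"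
      by (auto intro!: derivative_eq_intros)
    from has_derivative_compose[OF this F]
    have "((\<lambda>s. f (x + s *\<^sub>R u + t *\<^sub>R v)) has_derivative
        (\<lambda>k. frechet_derivative f (at ?y) (k *\<^sub>R u))) (at s)" .
    then show ?thesis
      using linear_scale[OF has_derivative_linear[OF F]]
      by (simp add: has_field_derivative_def f1_def mult_commute_abs)
  qed
  have d2: "((\<lambda>t. f1 (x + s *\<^sub>R u + t *\<^sub>R v)) has_real_derivative
        frechet_derivative f1 (at (x + s *\<^sub>R u + t *\<^sub>R v)) v) (at t)"
    if "s \<in> {0..h}" "t \<in> {0..h}" for s t
  proof -
    let ?y = "x + s *\<^sub>R u + t *\<^sub>R v"
    have F: "(f1 has_derivative frechet_derivative f1 (at ?y)) (at ?y)"
      using f'[OF in_ball[OF that]] by (simp add: frechet_derivative_works f1_def[abs_def])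
    have "((\<lambda>t. x + s *\<^sub>R u + t *\<^sub>R v) has_derivative (\<lambda>k. k *\<^sub>R v)) (at t)"
      by (auto intro!: derivative_eq_intros)
    from has_derivative_compose[OF this F]
    have "((\<lambda>t. f1 (x + s *\<^sub>R u + t *\<^sub>R v)) has_derivative
        (\<lambda>k. frechet_derivative f1 (at ?y) (k *\<^sub>R v))) (at t)" .
    then show ?thesis
      using linear_scale[OF has_derivative_linear[OF F]]
      by (simp add: has_field_derivative_def mult_commute_abs)
  qed
  \<comment> \<open>The summand \<open>0 *\<^sub>R v\<close> is kept so that both terms have the
    form treated in \<open>d1\<close>, with \<open>t = h\<close> and \<open>t = 0\<close>.\<close>
  define g where "g s = f (x + s *\<^sub>R u + h *\<^sub>R v) - f (x + s *\<^sub>R u + 0 *\<^sub>R v)" for s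
  have "\<exists>s>0. s < h \<and> g h - g 0 = (h - 0) * (f1 (x + s *\<^sub>R u + h *\<^sub>R v) - f1 (x + s *\<^sub>R u + 0 *\<^sub>R v))"
    unfolding g_def using h(1) by (intro MVT2 DERIV_diff d1) auto
  then obtain s where s: "0 < s" "s < h"
    and gs: "g h - g 0 = h * (f1 (x + s *\<^sub>R u + h *\<^sub>R v) - f1 (x + s *\<^sub>R u + 0 *\<^sub>R v))"
    by auto
  have "\<exists>t>0. t < h \<and> f1 (x + s *\<^sub>R u + h *\<^sub>R v) - f1 (x + s *\<^sub>R u + 0 *\<^sub>R v)
      = (h - 0) * frechet_derivative f1 (at (x + s *\<^sub>R u + t *\<^sub>R v)) v"
    using h(1) s by (intro MVT2 d2) auto
  then obtain t where t: "0 < t" "t < h"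
    and "f1 (x + s *\<^sub>R u + h *\<^sub>R v) - f1 (x + s *\<^sub>R u + 0 *\<^sub>R v)
      = h * frechet_derivative f1 (at (x + s *\<^sub>R u + t *\<^sub>R v)) v"
    by auto
  with gs have "g h - g 0 = h\<^sup>2 * frechet_derivative f1 (at (x + s *\<^sub>R u + t *\<^sub>R v)) v"
    by (simp add: power2_eq_square)
  then show ?thesis
    using that[of "x + s *\<^sub>R u + t *\<^sub>R v"] bnd[of s t] s t
    by (simp add: g_def f1_def[abs_def] algebra_simps)
qed

text \<open>The same second difference is \<open>h\<^sup>2\<close> times one mixed derivative at
  some \<open>y\<close> and \<open>h\<^sup>2\<close> times the other at some \<open>z\<close>, both
  close to \<open>x\<close>. Continuity of the mixed derivatives at \<open>x\<close> then excludes a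
  gap between them.\<close>

lemma frechet_derivative_commute_real:
  fixes f :: "'a::real_normed_vector \<Rightarrow> real"
  assumes "open S" "x \<in> S" and f: "times_differentiable_on 2 S f"
  shows "frechet_derivative (\<lambda>y. frechet_derivative f (at y) u) (at x) v
       = frechet_derivative (\<lambda>y. frechet_derivative f (at y) v) (at x) u"
proof (rule ccontr)
  define D where "D u v y = frechet_derivative (\<lambda>y. frechet_derivative f (at y) u) (at y) v" for u v y
  assume "\<not> ?thesis"
  \<comment> \<open>Half of the gap: two errors below this bound cannot add up to the gap.\<close>
  then have "0 < \<bar>D u v x - D v u x\<bar> / 2" (is "0 < ?e")
    by (simp add: D_def)
  have diff: "f differentiable (at y)" "(\<lambda>y. frechet_derivative f (at y) w) differentiable (at y)"
    if "y \<in> S" for y w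
    using f that by (auto simp: numeral_2_eq_2)
  have "isCont (D w z) x" for w z
    using f assms(1,2) by (auto simp: numeral_2_eq_2 D_def[abs_def] continuous_on_eq_continuous_at)
  then obtain d1 d2 where d: "d1 > 0" "d2 > 0"
    "\<And>y. dist y x < d1 \<Longrightarrow> dist (D u v y) (D u v x) < ?e"
    "\<And>y. dist y x < d2 \<Longrightarrow> dist (D v u y) (D v u x) < ?e"
    using \<open>0 < ?e\<close> unfolding continuous_at_eps_delta by metis
  obtain r where r: "r > 0" "ball x r \<subseteq> S"
    using assms(1,2) by (auto simp: open_contains_ball)
  define m where "m = min r (min d1 d2)"
  \<comment> \<open>The added 1 keeps the denominator positive when both directions vanish and makes
    \<open>h * (norm u + norm v)\<close> strictly smaller than \<open>m\<close>.\<close>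
  define h where "h = m / (norm u + norm v + 1)"
  have "0 < m" using r d by (simp add: m_def)
  have den: "0 < norm u + norm v + 1" by (simp add: add_nonneg_pos)
  have "0 < h" using \<open>0 < m\<close> den by (simp add: h_def)
  have "h * (norm u + norm v) < h * (norm u + norm v + 1)"
    using \<open>0 < h\<close> by (simp add: algebra_simps)
  also have "\<dots> = m"
    using den by (simp add: h_def)
  finally have hm: "h * (norm u + norm v) < m" .
  then have hr: "h * (norm u + norm v) < r" "h * (norm v + norm u) < r"
    by (auto simp: m_def add.commute)
  let ?\<Delta> = "f (x + h *\<^sub>R u + h *\<^sub>R v) - f (x + h *\<^sub>R u) - f (x + h *\<^sub>R v) + f x"
  obtain y where y: "norm (y - x) \<le> h * (norm u + norm v)" "?\<Delta> = h\<^sup>2 * D u v y"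
    unfolding D_def
    by (rule second_difference_mean_value[where f = f and u = u and v = v,
          OF diff[OF subsetD[OF r(2)]] \<open>0 < h\<close> hr(1)])
  obtain z where z: "norm (z - x) \<le> h * (norm v + norm u)"
      "f (x + h *\<^sub>R v + h *\<^sub>R u) - f (x + h *\<^sub>R v) - f (x + h *\<^sub>R u) + f x = h\<^sup>2 * D v u z"
    unfolding D_def
    by (rule second_difference_mean_value[where f = f and u = v and v = u,
          OF diff[OF subsetD[OF r(2)]] \<open>0 < h\<close> hr(2)])
  have "x + h *\<^sub>R v + h *\<^sub>R u = x + h *\<^sub>R u + h *\<^sub>R v"
    by simp
  with z(2) have "?\<Delta> = h\<^sup>2 * D v u z"
    by simp
  with y(2) have "h\<^sup>2 * D u v y = h\<^sup>2 * D v u z"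
    by (rule trans[OF sym])
  with \<open>0 < h\<close> have "D u v y = D v u z"
    by simp
  moreover have "dist y x < d1" "dist z x < d2"
    using y(1) z(1) hm by (auto simp: dist_norm m_def add.commute)
  then have "dist (D u v y) (D u v x) < ?e" "dist (D v u z) (D v u x) < ?e"
    using d by blast+
  ultimately show False
    by (auto simp: dist_real_def abs_if split: if_splits)
qed

text \<open>Taking the inner product with a basis vector is bounded linear and commutes with both
  differentiations, which reduces the claim to real-valued maps.\<close>

lemma frechet_derivative_commute:
  fixes f :: "'a::real_normed_vector \<Rightarrow> 'b::euclidean_space"
  assumes "open S" "x \<in> S" and f: "times_differentiable_on 2 S f"
  shows "frechet_derivative (\<lambda>y. frechet_derivative f (at y) u) (at x) v
       = frechet_derivative (\<lambda>y. frechet_derivative f (at y) v) (at x) u"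
proof (rule euclidean_eqI)
  fix b :: 'b
  have bl: "bounded_linear (\<lambda>y. y \<bullet> b)"
    by (rule bounded_linear_inner_left)
  have diff: "f differentiable (at y)" "(\<lambda>y. frechet_derivative f (at y) w) differentiable (at y)"
    if "y \<in> S" for y w
    using f that by (auto simp: numeral_2_eq_2)
  have "frechet_derivative (\<lambda>y. frechet_derivative f (at y) w) (at x) z \<bullet> b
      = frechet_derivative (\<lambda>y. frechet_derivative (\<lambda>y. f y \<bullet> b) (at y) w) (at x) z" for w z
  proof -
    have "frechet_derivative (\<lambda>y. frechet_derivative (\<lambda>y. f y \<bullet> b) (at y) w) (at x)
        = frechet_derivative (\<lambda>y. frechet_derivative f (at y) w \<bullet> b) (at x)"
      by (intro frechet_derivative_cong_open[OF assms(1,2)])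
        (simp add: frechet_derivative_bounded_linear[OF bl diff(1)])
    then show ?thesis
      using frechet_derivative_bounded_linear[OF bl diff(2)[OF assms(2)]] by simp
  qed
  then show "frechet_derivative (\<lambda>y. frechet_derivative f (at y) u) (at x) v \<bullet> b
      = frechet_derivative (\<lambda>y. frechet_derivative f (at y) v) (at x) u \<bullet> b"
    using frechet_derivative_commute_real[OF assms(1,2)
        times_differentiable_on_bounded_linear[OF assms(1) bl f]] by simp
qed

lemma pd_commute:
  fixes f :: "real ^ 2 \<Rightarrow> 'b::euclidean_space"
  assumes "open S" "x \<in> S" "smooth_on S f"
  shows "pd i (pd j f) x = pd j (pd i f) x"
  unfolding pd_def[abs_def]
  by (rule frechet_derivative_commute[OF assms(1,2) smooth_on_times_differentiable_on[OF assms(3)]])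

lemma pd_cong:
  "open S \<Longrightarrow> x \<in> S \<Longrightarrow> (\<And>y. y \<in> S \<Longrightarrow> f y = g y) \<Longrightarrow> pd i f x = pd i g x"
  unfolding pd_def using frechet_derivative_cong_open[of S x f g] by simp

lemma pd_bounded_linear:
  "bounded_linear h \<Longrightarrow> f differentiable (at x) \<Longrightarrow> pd i (\<lambda>x. h (f x)) x = h (pd i f x)"
  by (simp add: pd_def frechet_derivative_bounded_linear)

lemma pd_bounded_bilinear:
  "bounded_bilinear B \<Longrightarrow> f differentiable (at x) \<Longrightarrow> g differentiable (at x) \<Longrightarrow>
    pd i (\<lambda>x. B (f x) (g x)) x = B (pd i f x) (g x) + B (f x) (pd i g x)"
  by (simp add: pd_def frechet_derivative_bounded_bilinear)

lemma pd_add: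
  assumes "f differentiable (at x)" "g differentiable (at x)"
  shows "pd i (\<lambda>x. f x + g x) x = pd i f x + pd i g x"
  using fun_cong[OF frechet_derivative_at[OF
        has_derivative_add[OF assms[unfolded frechet_derivative_works]]], of "axis i 1"]
  by (simp add: pd_def)

subsection \<open>Bivectors\<close>

lemma UNIV_4_zero: "(UNIV :: 4 set) = {0, 1, 2, 3}"
proof -
  have "(4 :: 4) = 0" by simp
  then show ?thesis unfolding UNIV_4 by auto
qed

lemma UNIV_6_zero: "(UNIV :: 6 set) = {0, 1, 2, 3, 4, 5}"
proof -
  have "card {0, 1, 2, 3, 4, 5 :: 6} = CARD(6)" by simp
  then show ?thesis
    by (metis card_subset_eq finite top_greatest)
qed

lemma forall_4_zero: "(\<forall>i :: 4. P i) \<longleftrightarrow> P 0 \<and> P 1 \<and> P 2 \<and> P 3"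
  using UNIV_4_zero by (metis UNIV_I empty_iff insert_iff)

lemma forall_6_zero: "(\<forall>i :: 6. P i) \<longleftrightarrow> P 0 \<and> P 1 \<and> P 2 \<and> P 3 \<and> P 4 \<and> P 5"
  using UNIV_6_zero by (metis UNIV_I empty_iff insert_iff)

text \<open>Laplace expansion along the first two rows: each 2 by 2 minor of these rows meets the
  complementary minor of the other two. In this form the determinant is a pairing of Pluecker
  coordinates.\<close>

lemma det_4:
  fixes A :: "'a::comm_ring_1 ^ 4 ^ 4"
  shows "det A =
    (A$0$0 * A$1$1 - A$0$1 * A$1$0) * (A$2$2 * A$3$3 - A$2$3 * A$3$2)
  - (A$0$0 * A$1$2 - A$0$2 * A$1$0) * (A$2$1 * A$3$3 - A$2$3 * A$3$1)
  + (A$0$0 * A$1$3 - A$0$3 * A$1$0) * (A$2$1 * A$3$2 - A$2$2 * A$3$1)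
  + (A$0$1 * A$1$2 - A$0$2 * A$1$1) * (A$2$0 * A$3$3 - A$2$3 * A$3$0)
  - (A$0$1 * A$1$3 - A$0$3 * A$1$1) * (A$2$0 * A$3$2 - A$2$2 * A$3$0)
  + (A$0$2 * A$1$3 - A$0$3 * A$1$2) * (A$2$0 * A$3$1 - A$2$1 * A$3$0)"
proof -
  have f: "finite {1, 2, 3::4}" "0 \<notin> {1, 2, 3::4}" "finite {2, 3::4}" "1 \<notin> {2, 3::4}"
    "finite {3::4}" "2 \<notin> {3::4}"
    by auto
  show ?thesis
    unfolding det_def UNIV_4_zero
    unfolding sum_over_permutations_insert[OF f(1,2)]
    unfolding sum_over_permutations_insert[OF f(3,4)]
    unfolding sum_over_permutations_insert[OF f(5,6)]
    unfolding permutes_sing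
    by (simp add: sign_swap_id sign_id sign_compose permutation_swap_id
        permutation_compose swap_id_eq algebra_simps)
qed

text \<open>Conjugating the second argument makes the product bilinear. The coordinates of
  \<open>wedge\<close> diagonalize the Pluecker form p01 p23 + p02 p31 + p03 p12, and its
  polarization is half of the expansion in \<open>det_4\<close>.\<close>

lemma herm6_wedge_cnj: "herm6 (wedge a b) (cnj_vec (wedge c d)) = det4 a b c d / 2"
  by (simp add: det4_def det_4 herm6_def wedge_def cnj_vec_def Let_def field_simps)

lemma herm6_wedge:
  "herm6 (wedge a b) (wedge A B) = (herm4 a B * herm4 b A - herm4 a A * herm4 b B) / 2"
  by (simp add: herm4_def herm6_def wedge_def Let_def field_simps)

lemma wedge_add_left: "wedge (a + b) c = wedge a c + wedge b c"
  by (simp add: vec_eq_iff forall_6_zero wedge_def Let_def field_simps)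

lemma wedge_add_right: "wedge a (b + c) = wedge a b + wedge a c"
  by (simp add: vec_eq_iff forall_6_zero wedge_def Let_def field_simps)

lemma wedge_scale_left: "wedge (k *s a) b = k *s wedge a b"
  by (simp add: vec_eq_iff forall_6_zero wedge_def Let_def field_simps)

lemma wedge_scale_right: "wedge a (k *s b) = k *s wedge a b"
  by (simp add: vec_eq_iff forall_6_zero wedge_def Let_def field_simps)

lemma wedge_self: "wedge a a = 0"
  by (simp add: vec_eq_iff forall_6_zero wedge_def Let_def)

lemma wedge_commute: "wedge a b = - wedge b a"
  by (simp add: vec_eq_iff forall_6_zero wedge_def Let_def field_simps)

lemma wedge_diff_left: "wedge (a - b) c = wedge a c - wedge b c"
  by (simp add: vec_eq_iff forall_6_zero wedge_def Let_def field_simps)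

lemma wedge_diff_right: "wedge a (b - c) = wedge a b - wedge a c"
  by (simp add: vec_eq_iff forall_6_zero wedge_def Let_def field_simps)

lemmas wedge_linear = wedge_add_left wedge_add_right wedge_diff_left wedge_diff_right
  wedge_scale_left wedge_scale_right

lemma scaleR_vec_conv_of_real: "r *\<^sub>R x = complex_of_real r *s x"
  unfolding vec_eq_iff vector_scaleR_component by (simp add: scaleR_conv_of_real)

lemma bounded_bilinear_wedge: "bounded_bilinear wedge"
  unfolding bilinear_conv_bounded_bilinear[symmetric] bilinear_def
  by (auto intro!: linearI simp: wedge_linear scaleR_vec_conv_of_real)

lemma herm6_add_left: "herm6 (x + y) z = herm6 x z + herm6 y z"
  by (simp add: herm6_def algebra_simps)

lemma herm6_add_right: "herm6 z (x + y) = herm6 z x + herm6 z y"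
  by (simp add: herm6_def algebra_simps)

lemma herm6_diff_left: "herm6 (x - y) z = herm6 x z - herm6 y z"
  by (simp add: herm6_def algebra_simps)

lemma herm6_diff_right: "herm6 z (x - y) = herm6 z x - herm6 z y"
  by (simp add: herm6_def algebra_simps)

lemma herm6_scale_left: "herm6 (k *s x) y = k * herm6 x y"
  by (simp add: herm6_def algebra_simps)

lemma herm6_scale_right: "herm6 x (k *s y) = cnj k * herm6 x y"
  by (simp add: herm6_def algebra_simps)

lemmas herm6_linear = herm6_add_left herm6_add_right herm6_diff_left herm6_diff_right
  herm6_scale_left herm6_scale_right

lemma herm6_minus_left: "herm6 (- x) y = - herm6 x y"
  by (simp add: herm6_def)

lemma det4_same:
  "det4 a a c d = 0" "det4 a b a d = 0" "det4 a b c a = 0"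
  "det4 a b b d = 0" "det4 a b c b = 0" "det4 a b c c = 0"
  by (simp_all add: det4_def det_4 algebra_simps)

lemma det4_permute: "det4 c d a b = det4 a b c d" "det4 b d a c = - det4 a b c d"
  by (simp_all add: det4_def det_4 algebra_simps)

lemma det4_rows_span:
  assumes "det4 a b c d \<noteq> 0"
  obtains k l m n where "X = k *s a + l *s b + m *s c + n *s d"
proof
  \<comment> \<open>Cramer's rule\<close>
  show "X = (det4 X b c d / det4 a b c d) *s a + (det4 a X c d / det4 a b c d) *s b
    + (det4 a b X d / det4 a b c d) *s c + (det4 a b c X / det4 a b c d) *s d"
  proof -
    have "det4 a b c d *s X = det4 X b c d *s a + det4 a X c d *s b
      + det4 a b X d *s c + det4 a b c X *s d"
      by (simp add: vec_eq_iff forall_4_zero det4_def det_4) algebra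
    then show ?thesis
      using assms by (simp add: vec_eq_iff field_simps)
  qed
qed

text \<open>A nonzero determinant makes the four vectors a basis, so the six listed bivectors span
  all wedge products. As \<open>herm6\<close> is nondegenerate, products with them determine a
  vector.\<close>

lemma herm6_wedge_basis_eqI:
  assumes det: "det4 a b c d \<noteq> 0"
    and "herm6 (wedge a b) y = herm6 (wedge a b) z" "herm6 (wedge a c) y = herm6 (wedge a c) z"
    and "herm6 (wedge a d) y = herm6 (wedge a d) z" "herm6 (wedge b c) y = herm6 (wedge b c) z"
    and "herm6 (wedge b d) y = herm6 (wedge b d) z" "herm6 (wedge c d) y = herm6 (wedge c d) z"
  shows "y = z"
proof -
  define D where "D = y - z"
  have *: "herm6 (wedge a b) D = 0" "herm6 (wedge a c) D = 0" "herm6 (wedge a d) D = 0"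
    "herm6 (wedge b c) D = 0" "herm6 (wedge b d) D = 0" "herm6 (wedge c d) D = 0"
    using assms by (simp_all add: D_def herm6_diff_right)
  have "herm6 (wedge X Y) D = 0" for X Y
  proof -
    obtain k l m n where X: "X = k *s a + l *s b + m *s c + n *s d"
      by (rule det4_rows_span[OF det])
    obtain k' l' m' n' where Y: "Y = k' *s a + l' *s b + m' *s c + n' *s d"
      by (rule det4_rows_span[OF det])
    show ?thesis
      unfolding X Y
      by (simp add: wedge_linear wedge_self wedge_commute[of b a] wedge_commute[of c a]
          wedge_commute[of d a] wedge_commute[of c b] wedge_commute[of d b] wedge_commute[of d c]
          herm6_add_left herm6_diff_left herm6_scale_left herm6_minus_left *)
  qed
  \<comment> \<open>The wedges of standard basis vectors give six linear equations that force all
    six entries of \<open>D\<close> to vanish.\<close>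
  then have "herm6 (wedge (axis i 1) (axis j 1)) D = 0" for i j
    by blast
  from this[of 0 1] this[of 0 2] this[of 0 3] this[of 1 2] this[of 1 3] this[of 2 3]
  have "D = 0"
    by (simp add: vec_eq_iff forall_6_zero herm6_def wedge_def axis_def Let_def complex_eq_iff)
  then show ?thesis by (simp add: D_def)
qed

text \<open>Both sides are compared through their products with the six basis bivectors:
  determinants on the left, products of \<open>herm4\<close> on the right. Only
  \<open>wedge c d\<close> pairs nontrivially in the first claim, with 1/2 against the conjugate and
  -1/2 against \<open>wedge a b\<close>; in the second only \<open>wedge b d\<close> does, with -1/2
  in both cases.\<close>

lemma cnj_wedge_frame:
  assumes "normalized_frame p q a b c d"
  shows "cnj_vec (wedge a b) = - wedge a b" "cnj_vec (wedge a c) = wedge a c"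
proof -
  have herm4s: "herm4 a a = 0" "herm4 a b = 0" "herm4 a c = 0" "herm4 a d = - 1"
    "herm4 b a = 0" "herm4 b b = 0" "herm4 b c = 1" "herm4 b d = 0"
    "herm4 c a = 0" "herm4 c b = 1" "herm4 c c = 0" "herm4 c d = 0"
    "herm4 d a = - 1" "herm4 d b = 0" "herm4 d c = 0"
    and det: "det4 a b c d = 1"
    using assms by (simp_all add: normalized_frame_def)
  have dets: "det4 c d a b = 1" "det4 b d a c = - 1" "det4 a b c d \<noteq> 0"
    using det det4_permute[where a = a and b = b and c = c and d = d] by simp_all
  have minus: "herm6 x (- y) = - herm6 x y" for x y
    by (simp add: herm6_def)
  show "cnj_vec (wedge a b) = - wedge a b"
    by (rule herm6_wedge_basis_eqI[OF dets(3)])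
      (simp_all add: herm6_wedge_cnj herm6_wedge minus det4_same dets(1,2) herm4s)
  show "cnj_vec (wedge a c) = wedge a c"
    by (rule herm6_wedge_basis_eqI[OF dets(3)])
      (simp_all add: herm6_wedge_cnj herm6_wedge minus det4_same dets(1,2) herm4s)
qed

section \<open>Real vectors inside the complex space, and linear independence\<close>

text \<open>An injective real-linear embedding that turns \<open>lie_form\<close> into
  \<open>herm6\<close>; it transfers statements about the real parts of the spheres to the complex
  bivectors.\<close>

definition of_real_vec :: "real ^ 'n \<Rightarrow> complex ^ 'n" where
  "of_real_vec u = (\<chi> k. of_real (u $ k))"

lemma bounded_linear_of_real_vec: "bounded_linear of_real_vec"
  unfolding linear_conv_bounded_linear[symmetric]
  by (rule linearI) (simp_all add: of_real_vec_def scaleR_vec_conv_of_real vec_eq_iff)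

lemma bounded_linear_Re_vec: "bounded_linear Re_vec"
  unfolding linear_conv_bounded_linear[symmetric]
  by (rule linearI) (simp_all add: Re_vec_def vec_eq_iff)

lemma of_real_vec_inject: "of_real_vec u = of_real_vec v \<longleftrightarrow> u = v"
  by (simp add: of_real_vec_def vec_eq_iff)

lemma real_vec_of_real_vec: "real_vec (of_real_vec u)"
  by (simp add: real_vec_def of_real_vec_def)

lemma herm6_of_real_vec: "herm6 (of_real_vec u) (of_real_vec v) = of_real (lie_form u v)"
  by (simp add: herm6_def lie_form_def of_real_vec_def)

text \<open>Since \<open>\<i>\<close> is imaginary, the definition adds to \<open>\<i>\<close> times
  the bivector its own conjugate, so the imaginary parts cancel.\<close>

lemma of_real_vec_Re_sphere_U: "of_real_vec (Re_vec (sphere_U \<psi> x)) = sphere_U \<psi> x"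
  by (simp add: of_real_vec_def Re_vec_def sphere_U_def cnj_vec_def vec_eq_iff complex_eq_iff)

lemma of_real_vec_Re_sphere_V: "of_real_vec (Re_vec (sphere_V \<psi> x)) = sphere_V \<psi> x"
  by (simp add: of_real_vec_def Re_vec_def sphere_V_def cnj_vec_def vec_eq_iff complex_eq_iff)

lemma independent_4I:
  fixes u v s t :: "'a::real_vector"
  assumes "\<And>\<alpha> \<beta> \<gamma> \<delta>. \<alpha> *\<^sub>R u + \<beta> *\<^sub>R v + \<gamma> *\<^sub>R s + \<delta> *\<^sub>R t = 0
    \<Longrightarrow> \<alpha> = 0 \<and> \<beta> = 0 \<and> \<gamma> = 0 \<and> \<delta> = 0"
  shows "distinct [u, v, s, t] \<and> independent {u, v, s, t}"
proof -
  have dist: "distinct [u, v, s, t]"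
    \<comment> \<open>A coincidence of two of the vectors would be a relation with coefficients 1
      and -1. Distinctness is then what splits the sum over the set into four terms.\<close>
    using assms[of 1 "-1" 0 0] assms[of 1 0 "-1" 0] assms[of 1 0 0 "-1"]
      assms[of 0 1 "-1" 0] assms[of 0 1 0 "-1"] assms[of 0 0 1 "-1"] by auto
  moreover have "independent {u, v, s, t}"
  proof (rule independent_if_scalars_zero)
    fix f w
    assume "(\<Sum>x\<in>{u, v, s, t}. f x *\<^sub>R x) = 0" and w: "w \<in> {u, v, s, t}"
    then have "f u *\<^sub>R u + f v *\<^sub>R v + f s *\<^sub>R s + f t *\<^sub>R t = 0"
      using dist by (simp add: add.assoc)
    from assms[OF this] w show "f w = 0" by auto
  qed simp
  ultimately show ?thesis ..
qed

section \<open>Derivatives of scalar multiples\<close>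

lemma bounded_linear_vec_scale: "bounded_linear (\<lambda>y :: complex ^ 'n. k *s y)"
  unfolding linear_conv_bounded_linear[symmetric]
  by (rule linearI) (simp_all add: scaleR_vec_conv_of_real vec_eq_iff algebra_simps)

lemma pd_vec_scale:
  fixes f :: "real ^ 2 \<Rightarrow> complex ^ 'n"
  shows "f differentiable (at x) \<Longrightarrow> pd i (\<lambda>x. k *s f x) x = k *s pd i f x"
  by (rule pd_bounded_linear[OF bounded_linear_vec_scale])

text \<open>The coefficients in the equations for \<open>\<psi>\<close> are sums of complex
  constants times real functions. Keeping the constant \<open>k\<close> apart lets the product rule
  differentiate the real function itself.\<close>

lemma bounded_bilinear_of_real_scale:
  "bounded_bilinear (\<lambda>r (y :: complex ^ 'n). (k * of_real r) *s y)"
  unfolding bilinear_conv_bounded_bilinear[symmetric] bilinear_def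
  by (auto intro!: linearI simp: scaleR_vec_conv_of_real vec_eq_iff algebra_simps)

lemma pd_of_real_scale:
  fixes f :: "real ^ 2 \<Rightarrow> real" and g :: "real ^ 2 \<Rightarrow> complex ^ 'n"
  assumes "f differentiable (at x)" "g differentiable (at x)"
  shows "pd i (\<lambda>x. (k * of_real (f x)) *s g x) x
    = (k * of_real (pd i f x)) *s g x + (k * of_real (f x)) *s pd i g x"
  by (rule pd_bounded_bilinear[OF bounded_bilinear_of_real_scale assms])

lemma differentiable_of_real_scale:
  fixes f :: "real ^ 2 \<Rightarrow> real" and g :: "real ^ 2 \<Rightarrow> complex ^ 'n"
  assumes "f differentiable (at x)" "g differentiable (at x)"
  shows "(\<lambda>x. (k * of_real (f x)) *s g x) differentiable (at x)"
  by (rule bounded_bilinear_differentiable_at[OF bounded_bilinear_of_real_scale assms])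

subsection \<open>The curvature spheres\<close>

text \<open>Pointwise algebra, with free vectors in place of the derivatives. In the product of
  \<open>U22\<close> with \<open>V11\<close>, up to the outer scalars, \<open>wedge c d\<close>
  against \<open>wedge b d\<close> contributes 2 p q, and the two terms with coefficient p q
  contribute - p q each. The products after the orthogonality claim serve linear
  independence.\<close>

lemma sphere_pairings:
  fixes p q V W :: real
  assumes "normalized_frame p q a b c d"
    and U: "U = (2 * \<i>) *s wedge a b" "U2 = (2 * \<i>) *s (wedge a d - wedge b c)"
      "U22 = (2 * \<i>) *s (of_real W *s wedge a b + 2 *s wedge c d + of_real (p * q) *s wedge a c)"
    and V: "V0 = 2 *s wedge a c" "V1 = 2 *s (wedge a d + wedge b c)"
      "V11 = 2 *s (of_real V *s wedge a c + 2 *s wedge b d + of_real (p * q) *s wedge a b)"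
  shows "herm6 U U = 0" "herm6 V0 V0 = 0"
    and "\<And>u v. u \<in> {U, U2, U22} \<Longrightarrow> v \<in> {V0, V1, V11} \<Longrightarrow> herm6 u v = 0"
    and "herm6 U U2 = 0" "herm6 V0 U2 = 0" "herm6 V1 U2 = 0" "herm6 U2 U2 = 4"
    and "herm6 V0 V1 = 0" "herm6 V1 V1 = 4"
    and "herm6 U U22 = - 4" "herm6 V0 U22 = 0" "herm6 V0 V11 = - 4"
proof -
  have herm4s: "herm4 a a = 0" "herm4 a b = 0" "herm4 a c = 0" "herm4 a d = - 1"
    "herm4 b a = 0" "herm4 b b = 0" "herm4 b c = 1" "herm4 b d = 0"
    "herm4 c a = 0" "herm4 c b = 1" "herm4 c c = 0" "herm4 c d = 0"
    "herm4 d a = - 1" "herm4 d b = 0" "herm4 d c = 0" "herm4 d d = - of_real (p * q)"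
    using assms(1) by (simp_all add: normalized_frame_def)
  show "herm6 u v = 0" if "u \<in> {U, U2, U22}" "v \<in> {V0, V1, V11}" for u v
    using that by (auto simp: U V herm6_linear herm6_wedge herm4s)
qed (use assms(1) in \<open>simp_all add: U V herm6_linear herm6_wedge normalized_frame_def\<close>)

section \<open>Derivatives of the frame and of the two spheres\<close>

locale surface_frame =
  fixes \<Omega> :: "(real ^ 2) set" and p q V W :: "real ^ 2 \<Rightarrow> real" and \<psi> :: "real ^ 2 \<Rightarrow> complex ^ 4"
  assumes open_\<Omega>: "open \<Omega>"
    and smooth: "smooth_on \<Omega> p" "smooth_on \<Omega> q" "smooth_on \<Omega> V" "smooth_on \<Omega> W" "smooth_on \<Omega> \<psi>"
    and pd11: "x \<in> \<Omega> \<Longrightarrow> pd 1 (pd 1 \<psi>) x = (- \<i> * of_real (p x)) *s pd 2 \<psi> x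
        + ((of_real (V x) + \<i> * of_real (pd 2 p x)) / 2) *s \<psi> x"
    and pd22: "x \<in> \<Omega> \<Longrightarrow> pd 2 (pd 2 \<psi>) x = (\<i> * of_real (q x)) *s pd 1 \<psi> x
        + ((of_real (W x) - \<i> * of_real (pd 1 q x)) / 2) *s \<psi> x"
    and frame: "x \<in> \<Omega> \<Longrightarrow>
      normalized_frame (p x) (q x) (\<psi> x) (pd 1 \<psi> x) (pd 2 \<psi> x) (pd 1 (pd 2 \<psi>) x)"
begin

lemmas diff = smooth[THEN smooth_on_imp_differentiable]
  smooth[THEN smooth_on_pd, THEN smooth_on_imp_differentiable]
  smooth_on_imp_differentiable[OF smooth_on_pd[OF smooth_on_pd[OF smooth(5)]]]

lemma pd21: "x \<in> \<Omega> \<Longrightarrow> pd 2 (pd 1 \<psi>) x = pd 1 (pd 2 \<psi>) x"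
  by (rule pd_commute[OF open_\<Omega> _ smooth(5)])

text \<open>By symmetry of second derivatives this is the second equation for \<open>\<psi>\<close>
  differentiated along the first coordinate, with the first equation inserted; \<open>\<i> q\<close>
  times \<open>- \<i> p\<close> gives the coefficient p q. The multiple of \<open>\<psi>\<close>
  stays anonymous because its wedge with \<open>\<psi>\<close> vanishes.\<close>

lemma pd212:
  assumes x: "x \<in> \<Omega>"
  obtains \<kappa> where "pd 2 (pd 1 (pd 2 \<psi>)) x =
    ((of_real (W x) + \<i> * of_real (pd 1 q x)) / 2) *s pd 1 \<psi> x
    + of_real (p x * q x) *s pd 2 \<psi> x + \<kappa> *s \<psi> x"
proof
  have "pd 2 (pd 1 (pd 2 \<psi>)) x = pd 1 (pd 2 (pd 2 \<psi>)) x"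
    by (rule pd_commute[OF open_\<Omega> x smooth_on_pd[OF smooth(5)]])
  \<comment> \<open>The coefficient of \<open>\<psi>\<close> is split into constants times real
    functions, as \<open>pd_of_real_scale\<close> requires.\<close>
  also have "\<dots> = pd 1 (\<lambda>y. (\<i> * of_real (q y)) *s pd 1 \<psi> y + ((1 / 2) * of_real (W y)) *s \<psi> y
      + ((- \<i> / 2) * of_real (pd 1 q y)) *s \<psi> y) x"
    by (rule pd_cong[OF open_\<Omega> x]) (simp add: pd22 vec_eq_iff field_simps)
  also have "\<dots> = (\<i> * of_real (pd 1 q x)) *s pd 1 \<psi> x + (\<i> * of_real (q x)) *s pd 1 (pd 1 \<psi>) x
      + ((1 / 2 * of_real (pd 1 W x)) *s \<psi> x + (1 / 2 * of_real (W x)) *s pd 1 \<psi> x)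
      + ((- \<i> / 2 * of_real (pd 1 (pd 1 q) x)) *s \<psi> x + (- \<i> / 2 * of_real (pd 1 q x)) *s pd 1 \<psi> x)"
    using x by (simp only: pd_add pd_of_real_scale differentiable_add differentiable_of_real_scale diff)
  also have "\<dots> =
      ((of_real (W x) + \<i> * of_real (pd 1 q x)) / 2) *s pd 1 \<psi> x
      + of_real (p x * q x) *s pd 2 \<psi> x
      + (\<i> * of_real (q x) * ((of_real (V x) + \<i> * of_real (pd 2 p x)) / 2)
        + of_real (pd 1 W x) / 2 - \<i> * of_real (pd 1 (pd 1 q) x) / 2) *s \<psi> x"
    by (simp add: pd11[OF x] vec_eq_iff field_simps)
  finally show "pd 2 (pd 1 (pd 2 \<psi>)) x = \<dots>" .
qed

lemma pd112:
  assumes x: "x \<in> \<Omega>"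
  obtains \<kappa> where "pd 1 (pd 1 (pd 2 \<psi>)) x =
    ((of_real (V x) - \<i> * of_real (pd 2 p x)) / 2) *s pd 2 \<psi> x
    + of_real (p x * q x) *s pd 1 \<psi> x + \<kappa> *s \<psi> x"
proof
  \<comment> \<open>Two exchanges are needed here: first the inner mixed derivative, then the outer
    pair, to reach a derivative of the first equation.\<close>
  have "pd 1 (pd 1 (pd 2 \<psi>)) x = pd 1 (pd 2 (pd 1 \<psi>)) x"
    by (rule pd_cong[OF open_\<Omega> x]) (simp add: pd21)
  also have "\<dots> = pd 2 (pd 1 (pd 1 \<psi>)) x"
    by (rule pd_commute[OF open_\<Omega> x smooth_on_pd[OF smooth(5)]])
  also have "\<dots> = pd 2 (\<lambda>y. (- \<i> * of_real (p y)) *s pd 2 \<psi> y + ((1 / 2) * of_real (V y)) *s \<psi> y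
      + ((\<i> / 2) * of_real (pd 2 p y)) *s \<psi> y) x"
    by (rule pd_cong[OF open_\<Omega> x]) (simp add: pd11 vec_eq_iff field_simps)
  also have "\<dots> = (- \<i> * of_real (pd 2 p x)) *s pd 2 \<psi> x + (- \<i> * of_real (p x)) *s pd 2 (pd 2 \<psi>) x
      + ((1 / 2 * of_real (pd 2 V x)) *s \<psi> x + (1 / 2 * of_real (V x)) *s pd 2 \<psi> x)
      + ((\<i> / 2 * of_real (pd 2 (pd 2 p) x)) *s \<psi> x + (\<i> / 2 * of_real (pd 2 p x)) *s pd 2 \<psi> x)"
    using x by (simp only: pd_add pd_of_real_scale differentiable_add differentiable_of_real_scale diff)
  also have "\<dots> =
      ((of_real (V x) - \<i> * of_real (pd 2 p x)) / 2) *s pd 2 \<psi> x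
      + of_real (p x * q x) *s pd 1 \<psi> x
      + (- \<i> * of_real (p x) * ((of_real (W x) - \<i> * of_real (pd 1 q x)) / 2)
        + of_real (pd 2 V x) / 2 + \<i> * of_real (pd 2 (pd 2 p) x) / 2) *s \<psi> x"
    by (simp add: pd22[OF x] vec_eq_iff field_simps)
  finally show "pd 1 (pd 1 (pd 2 \<psi>)) x = \<dots>" .
qed

lemma sphere_U_eq: "x \<in> \<Omega> \<Longrightarrow> sphere_U \<psi> x = (2 * \<i>) *s wedge (\<psi> x) (pd 1 \<psi> x)"
  by (simp add: sphere_U_def cnj_wedge_frame(1)[OF frame] vec_eq_iff)

lemma sphere_V_eq: "x \<in> \<Omega> \<Longrightarrow> sphere_V \<psi> x = 2 *s wedge (\<psi> x) (pd 2 \<psi> x)"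
  by (simp add: sphere_V_def cnj_wedge_frame(2)[OF frame] vec_eq_iff)

lemmas pd_wedge = pd_bounded_bilinear[OF bounded_bilinear_wedge]

lemmas differentiable_wedge = bounded_bilinear_differentiable_at[OF bounded_bilinear_wedge]

lemma pd_sphere_U:
  assumes x: "x \<in> \<Omega>"
  shows "pd i (sphere_U \<psi>) x =
    (2 * \<i>) *s (wedge (pd i \<psi> x) (pd 1 \<psi> x) + wedge (\<psi> x) (pd i (pd 1 \<psi>) x))"
proof -
  have "pd i (sphere_U \<psi>) x = pd i (\<lambda>y. (2 * \<i>) *s wedge (\<psi> y) (pd 1 \<psi> y)) x"
    by (rule pd_cong[OF open_\<Omega> x]) (rule sphere_U_eq)
  then show ?thesis
    using x by (simp add: pd_vec_scale pd_wedge differentiable_wedge diff)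
qed

lemma pd_sphere_V:
  assumes x: "x \<in> \<Omega>"
  shows "pd i (sphere_V \<psi>) x =
    2 *s (wedge (pd i \<psi> x) (pd 2 \<psi> x) + wedge (\<psi> x) (pd i (pd 2 \<psi>) x))"
proof -
  have "pd i (sphere_V \<psi>) x = pd i (\<lambda>y. 2 *s wedge (\<psi> y) (pd 2 \<psi> y)) x"
    by (rule pd_cong[OF open_\<Omega> x]) (rule sphere_V_eq)
  then show ?thesis
    using x by (simp add: pd_vec_scale pd_wedge differentiable_wedge diff)
qed

text \<open>The wedges of \<open>\<psi>\<close> and of its first derivative with themselves vanish,
  so only the term \<open>- \<i> p\<close> in the first equation survives, and \<open>2 \<i>\<close>
  times it is 2 p.\<close>

lemma pd1_sphere_U:
  assumes x: "x \<in> \<Omega>"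
  shows "pd 1 (sphere_U \<psi>) x = of_real (p x) *s sphere_V \<psi> x"
  by (simp add: pd_sphere_U[OF x] sphere_V_eq[OF x] pd11[OF x] wedge_linear wedge_self vec_eq_iff)

lemma pd2_sphere_V:
  assumes x: "x \<in> \<Omega>"
  shows "pd 2 (sphere_V \<psi>) x = of_real (q x) *s sphere_U \<psi> x"
  by (simp add: pd_sphere_V[OF x] sphere_U_eq[OF x] pd22[OF x] wedge_linear wedge_self vec_eq_iff)

lemma pd2_sphere_U:
  assumes x: "x \<in> \<Omega>"
  shows "pd 2 (sphere_U \<psi>) x =
    (2 * \<i>) *s (wedge (\<psi> x) (pd 1 (pd 2 \<psi>) x) - wedge (pd 1 \<psi> x) (pd 2 \<psi> x))"
  by (simp add: pd_sphere_U[OF x] pd21[OF x] wedge_commute[of "pd 2 \<psi> x"] vec_eq_iff)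

lemma pd1_sphere_V:
  assumes x: "x \<in> \<Omega>"
  shows "pd 1 (sphere_V \<psi>) x =
    2 *s (wedge (\<psi> x) (pd 1 (pd 2 \<psi>) x) + wedge (pd 1 \<psi> x) (pd 2 \<psi> x))"
  by (simp add: pd_sphere_V[OF x] add.commute)

text \<open>The coefficient of \<open>\<psi> \<and> \<partial>\<^sub>1\<psi>\<close> is half of W -
  \<open>\<i>\<close> \<open>pd 1 q\<close> from the second equation plus half of W +
  \<open>\<i>\<close> \<open>pd 1 q\<close> from \<open>pd212\<close>, so the derivative of q
  cancels.\<close>

lemma pd22_sphere_U:
  assumes x: "x \<in> \<Omega>"
  shows "pd 2 (pd 2 (sphere_U \<psi>)) x =
    (2 * \<i>) *s (of_real (W x) *s wedge (\<psi> x) (pd 1 \<psi> x) + 2 *s wedge (pd 2 \<psi> x) (pd 1 (pd 2 \<psi>) x)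
      + of_real (p x * q x) *s wedge (\<psi> x) (pd 2 \<psi> x))"
proof -
  obtain \<kappa> where \<kappa>: "pd 2 (pd 1 (pd 2 \<psi>)) x =
      ((of_real (W x) + \<i> * of_real (pd 1 q x)) / 2) *s pd 1 \<psi> x
      + of_real (p x * q x) *s pd 2 \<psi> x + \<kappa> *s \<psi> x"
    by (rule pd212[OF x])
  have "pd 2 (pd 2 (sphere_U \<psi>)) x = pd 2 (\<lambda>y. (2 * \<i>) *s (wedge (pd 2 \<psi> y) (pd 1 \<psi> y)
      + wedge (\<psi> y) (pd 1 (pd 2 \<psi>) y))) x"
    by (rule pd_cong[OF open_\<Omega> x]) (simp add: pd_sphere_U pd21)
  also have "\<dots> = (2 * \<i>) *s (wedge (pd 2 (pd 2 \<psi>) x) (pd 1 \<psi> x)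
      + wedge (pd 2 \<psi> x) (pd 1 (pd 2 \<psi>) x)
      + (wedge (pd 2 \<psi> x) (pd 1 (pd 2 \<psi>) x) + wedge (\<psi> x) (pd 2 (pd 1 (pd 2 \<psi>)) x)))"
    using x by (simp only: pd_vec_scale pd_add pd_wedge differentiable_add
        differentiable_wedge diff pd21)
  finally show ?thesis
    unfolding \<kappa> pd22[OF x]
    by (simp add: wedge_linear wedge_self vec_eq_iff field_simps)
qed

text \<open>Here the terms with \<open>pd 2 p\<close> cancel in the coefficient of
  \<open>\<psi> \<and> \<partial>\<^sub>2\<psi>\<close>.\<close>

lemma pd11_sphere_V:
  assumes x: "x \<in> \<Omega>"
  shows "pd 1 (pd 1 (sphere_V \<psi>)) x =
    2 *s (of_real (V x) *s wedge (\<psi> x) (pd 2 \<psi> x) + 2 *s wedge (pd 1 \<psi> x) (pd 1 (pd 2 \<psi>) x)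
      + of_real (p x * q x) *s wedge (\<psi> x) (pd 1 \<psi> x))"
proof -
  obtain \<kappa> where \<kappa>: "pd 1 (pd 1 (pd 2 \<psi>)) x =
      ((of_real (V x) - \<i> * of_real (pd 2 p x)) / 2) *s pd 2 \<psi> x
      + of_real (p x * q x) *s pd 1 \<psi> x + \<kappa> *s \<psi> x"
    by (rule pd112[OF x])
  have "pd 1 (pd 1 (sphere_V \<psi>)) x = pd 1 (\<lambda>y. 2 *s (wedge (pd 1 \<psi> y) (pd 2 \<psi> y)
      + wedge (\<psi> y) (pd 1 (pd 2 \<psi>) y))) x"
    by (rule pd_cong[OF open_\<Omega> x]) (rule pd_sphere_V)
  also have "\<dots> = 2 *s (wedge (pd 1 (pd 1 \<psi>) x) (pd 2 \<psi> x)
      + wedge (pd 1 \<psi> x) (pd 1 (pd 2 \<psi>) x)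
      + (wedge (pd 1 \<psi> x) (pd 1 (pd 2 \<psi>) x) + wedge (\<psi> x) (pd 1 (pd 1 (pd 2 \<psi>)) x)))"
    using x by (simp only: pd_vec_scale pd_add pd_wedge differentiable_add
        differentiable_wedge diff)
  finally show ?thesis
    unfolding \<kappa> pd11[OF x]
    by (simp add: wedge_linear wedge_self vec_eq_iff field_simps)
qed

lemmas pairings = sphere_pairings[OF frame sphere_U_eq pd2_sphere_U pd22_sphere_U
    sphere_V_eq pd1_sphere_V pd11_sphere_V]

section \<open>Passage to real hexaspherical coordinates\<close>

lemma smooth_Re_sphere_U: "smooth_on \<Omega> (\<lambda>x. Re_vec (sphere_U \<psi> x))"
proof (rule smooth_on_bounded_linear[OF open_\<Omega> bounded_linear_Re_vec])
  have "smooth_on \<Omega> (\<lambda>x. (2 * \<i>) *s wedge (\<psi> x) (pd 1 \<psi> x))"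
    by (rule smooth_on_bounded_linear[OF open_\<Omega> bounded_linear_vec_scale
          smooth_on_bounded_bilinear[OF open_\<Omega> bounded_bilinear_wedge smooth(5) smooth_on_pd[OF smooth(5)]]])
  then show "smooth_on \<Omega> (sphere_U \<psi>)"
    by (rule smooth_on_cong[OF open_\<Omega>, rotated]) (rule sphere_U_eq[symmetric])
qed

lemma smooth_Re_sphere_V: "smooth_on \<Omega> (\<lambda>x. Re_vec (sphere_V \<psi> x))"
proof (rule smooth_on_bounded_linear[OF open_\<Omega> bounded_linear_Re_vec])
  have "smooth_on \<Omega> (\<lambda>x. 2 *s wedge (\<psi> x) (pd 2 \<psi> x))"
    by (rule smooth_on_bounded_linear[OF open_\<Omega> bounded_linear_vec_scale
          smooth_on_bounded_bilinear[OF open_\<Omega> bounded_bilinear_wedge smooth(5) smooth_on_pd[OF smooth(5)]]])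
  then show "smooth_on \<Omega> (sphere_V \<psi>)"
    by (rule smooth_on_cong[OF open_\<Omega>, rotated]) (rule sphere_V_eq[symmetric])
qed

text \<open>The embedding is bounded linear, hence commutes with \<open>pd i\<close>, and it undoes
  taking real parts of the sphere.\<close>

lemma of_real_vec_pd_Re_sphere_U:
  assumes x: "x \<in> \<Omega>"
  shows "of_real_vec (pd i (\<lambda>x. Re_vec (sphere_U \<psi> x)) x) = pd i (sphere_U \<psi>) x"
  using pd_bounded_linear[OF bounded_linear_of_real_vec
      smooth_on_imp_differentiable[OF smooth_Re_sphere_U x], of i]
  by (simp add: of_real_vec_Re_sphere_U)

lemma of_real_vec_pd_Re_sphere_V:
  assumes x: "x \<in> \<Omega>"
  shows "of_real_vec (pd i (\<lambda>x. Re_vec (sphere_V \<psi> x)) x) = pd i (sphere_V \<psi>) x"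
  using pd_bounded_linear[OF bounded_linear_of_real_vec
      smooth_on_imp_differentiable[OF smooth_Re_sphere_V x], of i]
  by (simp add: of_real_vec_Re_sphere_V)

lemma curvature_spheres_Re_sphere:
  "curvature_spheres \<Omega> (\<lambda>x. Re_vec (sphere_U \<psi> x)) (\<lambda>x. Re_vec (sphere_V \<psi> x))"
proof -
  define u where "u x = Re_vec (sphere_U \<psi> x)" for x
  define v where "v x = Re_vec (sphere_V \<psi> x)" for x
  have uv: "of_real_vec (u x) = sphere_U \<psi> x" "of_real_vec (v x) = sphere_V \<psi> x" for x
    by (simp_all add: u_def v_def of_real_vec_Re_sphere_U of_real_vec_Re_sphere_V)
  have pd_uv: "of_real_vec (pd i u x) = pd i (sphere_U \<psi>) x"
    "of_real_vec (pd i v x) = pd i (sphere_V \<psi>) x" if "x \<in> \<Omega>" for i x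
    using that by (simp_all add: u_def[abs_def] v_def[abs_def]
        of_real_vec_pd_Re_sphere_U of_real_vec_pd_Re_sphere_V)
  have scale: "of_real_vec (r *\<^sub>R y) = of_real r *s of_real_vec y" for r and y :: "real ^ 6"
    by (simp add: of_real_vec_def vec_eq_iff)
  have add: "of_real_vec (y + z) = of_real_vec y + of_real_vec z" for y z :: "real ^ 6"
    by (simp add: of_real_vec_def vec_eq_iff)
  have "curvature_spheres \<Omega> u v"
    unfolding curvature_spheres_def
  proof (intro conjI ballI)
    show "smooth_on \<Omega> u" "smooth_on \<Omega> v"
      using smooth_Re_sphere_U smooth_Re_sphere_V by (simp_all add: u_def[abs_def] v_def[abs_def])
  next
    fix x assume x: "x \<in> \<Omega>"
    note P = pairings[OF x x x x x x x]
    show "lie_form (u x) (u x) = 0" "lie_form (u x) (v x) = 0" "lie_form (v x) (v x) = 0"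
      using P(1,2) P(3)[of "sphere_U \<psi> x" "sphere_V \<psi> x"]
      by (simp_all flip: uv add: herm6_of_real_vec)
    have "pd 1 u x = p x *\<^sub>R v x" "pd 2 v x = q x *\<^sub>R u x"
      using x by (simp_all flip: of_real_vec_inject
          add: scale uv pd_uv pd1_sphere_U pd2_sphere_V)
    then show "pd 1 u x \<in> span {u x, v x}" "pd 2 v x \<in> span {u x, v x}"
      by (simp_all add: span_base span_scale)
    have "distinct [u x, v x, pd 2 u x, pd 1 v x] \<and> independent {u x, v x, pd 2 u x, pd 1 v x}"
    proof (rule independent_4I)
      fix \<alpha> \<beta> \<gamma> \<delta> :: real
      assume "\<alpha> *\<^sub>R u x + \<beta> *\<^sub>R v x + \<gamma> *\<^sub>R pd 2 u x + \<delta> *\<^sub>R pd 1 v x = 0" (is "?s = 0")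
      then have "of_real_vec ?s = 0"
        by (simp add: of_real_vec_def vec_eq_iff)
      then have "of_real \<alpha> *s sphere_U \<psi> x + of_real \<beta> *s sphere_V \<psi> x
          + of_real \<gamma> *s pd 2 (sphere_U \<psi>) x + of_real \<delta> *s pd 1 (sphere_V \<psi>) x = 0"
        using x by (simp add: add scale uv pd_uv)
      then have "herm6 (of_real \<alpha> *s sphere_U \<psi> x + of_real \<beta> *s sphere_V \<psi> x
          + of_real \<gamma> *s pd 2 (sphere_U \<psi>) x + of_real \<delta> *s pd 1 (sphere_V \<psi>) x) y = 0" for y
        by (simp add: herm6_def)
      then have *: "\<alpha> * herm6 (sphere_U \<psi> x) y + \<beta> * herm6 (sphere_V \<psi> x) y
          + \<gamma> * herm6 (pd 2 (sphere_U \<psi>) x) y + \<delta> * herm6 (pd 1 (sphere_V \<psi>) x) y = 0" for y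
        by (simp add: herm6_linear)
      have \<gamma>: "\<gamma> = 0"
        using *[of "pd 2 (sphere_U \<psi>) x"] by (simp add: P)
      have \<delta>: "\<delta> = 0"
        using *[of "pd 1 (sphere_V \<psi>) x"] by (simp add: P)
      \<comment> \<open>Both spheres are orthogonal to all four vectors, so the Gram matrix of these
        is singular. The second derivatives detect the remaining coefficients, through products
        equal to -4.\<close>
      have "\<alpha> = 0"
        using *[of "pd 2 (pd 2 (sphere_U \<psi>)) x"] by (simp add: P \<gamma> \<delta>)
      moreover have "\<beta> = 0"
        using *[of "pd 1 (pd 1 (sphere_V \<psi>)) x"] by (simp add: P \<gamma> \<delta>)
      ultimately show "\<alpha> = 0 \<and> \<beta> = 0 \<and> \<gamma> = 0 \<and> \<delta> = 0"
        using \<gamma> \<delta> by simp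
    qed
    then show "distinct [u x, v x, pd 2 u x, pd 1 v x]"
      "independent {u x, v x, pd 2 u x, pd 1 v x}"
      by simp_all
  qed
  then show ?thesis
    by (simp add: u_def[abs_def] v_def[abs_def])
qed

end

theorem theorem1:
  fixes \<Omega> :: "(real ^ 2) set"
    and p q V W :: "real ^ 2 \<Rightarrow> real"
    and \<psi> :: "real ^ 2 \<Rightarrow> complex ^ 4"
  assumes "open \<Omega>" and "connected \<Omega>"
    and "smooth_on \<Omega> p" and "smooth_on \<Omega> q" and "smooth_on \<Omega> V" and "smooth_on \<Omega> W"
    and "smooth_on \<Omega> \<psi>"
    and "\<And>x. x \<in> \<Omega> \<Longrightarrow> p x \<noteq> 0" and "\<And>x. x \<in> \<Omega> \<Longrightarrow> q x \<noteq> 0"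
    and "\<And>x. x \<in> \<Omega> \<Longrightarrow>
           pd 2 (pd 2 (pd 2 p)) x - 2 * W x * pd 2 p x - p x * pd 2 W x
         + pd 1 (pd 1 (pd 1 q)) x - 2 * V x * pd 1 q x - q x * pd 1 V x = 0"
    and "\<And>x. x \<in> \<Omega> \<Longrightarrow> pd 1 W x = 2 * q x * pd 2 p x + p x * pd 2 q x"
    and "\<And>x. x \<in> \<Omega> \<Longrightarrow> pd 2 V x = 2 * p x * pd 1 q x + q x * pd 1 p x"
    and "\<And>x. x \<in> \<Omega> \<Longrightarrow>
           pd 1 (pd 1 \<psi>) x
           = (- \<i> * of_real (p x)) *s pd 2 \<psi> x
             + ((of_real (V x) + \<i> * of_real (pd 2 p x)) / 2) *s \<psi> x"
    and "\<And>x. x \<in> \<Omega> \<Longrightarrow>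
           pd 2 (pd 2 \<psi>) x
           = (\<i> * of_real (q x)) *s pd 1 \<psi> x
             + ((of_real (W x) - \<i> * of_real (pd 1 q x)) / 2) *s \<psi> x"
    and "\<And>x. x \<in> \<Omega> \<Longrightarrow>
           normalized_frame (p x) (q x) (\<psi> x) (pd 1 \<psi> x) (pd 2 \<psi> x) (pd 1 (pd 2 \<psi>) x)"
  shows "(\<forall>x\<in>\<Omega>. real_vec (sphere_U \<psi> x) \<and> real_vec (sphere_V \<psi> x)) \<and>
         (\<forall>x\<in>\<Omega>. herm6 (sphere_U \<psi> x) (sphere_U \<psi> x) = 0 \<and>
                 herm6 (sphere_V \<psi> x) (sphere_V \<psi> x) = 0) \<and>
         (\<forall>x\<in>\<Omega>. \<forall>u \<in> {sphere_U \<psi> x, pd 2 (sphere_U \<psi>) x, pd 2 (pd 2 (sphere_U \<psi>)) x}.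
                 \<forall>v \<in> {sphere_V \<psi> x, pd 1 (sphere_V \<psi>) x, pd 1 (pd 1 (sphere_V \<psi>)) x}.
                   herm6 u v = 0) \<and>
         curvature_spheres \<Omega> (\<lambda>x. Re_vec (sphere_U \<psi> x)) (\<lambda>x. Re_vec (sphere_V \<psi> x))"
proof -
  interpret surface_frame \<Omega> p q V W \<psi>
    using assms(1,3-7,13-15) by unfold_locales
  have "real_vec (sphere_U \<psi> x)" "real_vec (sphere_V \<psi> x)" for x
    using real_vec_of_real_vec[of "Re_vec (sphere_U \<psi> x)"]
      real_vec_of_real_vec[of "Re_vec (sphere_V \<psi> x)"]
    by (simp_all add: of_real_vec_Re_sphere_U of_real_vec_Re_sphere_V)
  moreover have "herm6 (sphere_U \<psi> x) (sphere_U \<psi> x) = 0" "herm6 (sphere_V \<psi> x) (sphere_V \<psi> x) = 0"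
    if "x \<in> \<Omega>" for x
    using pairings(1,2)[OF that that that that that that that] by blast+
  moreover have "herm6 u v = 0"
    if "x \<in> \<Omega>" "u \<in> {sphere_U \<psi> x, pd 2 (sphere_U \<psi>) x, pd 2 (pd 2 (sphere_U \<psi>)) x}"
      "v \<in> {sphere_V \<psi> x, pd 1 (sphere_V \<psi>) x, pd 1 (pd 1 (sphere_V \<psi>)) x}" for x u v
    by (rule pairings(3)[OF that(1) that(1) that(1) that(1) that(1) that(1) that(1) that(2,3)])
  ultimately show ?thesis
    using curvature_spheres_Re_sphere by blast
qed

end
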